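(* Let $\mathcal{R} = (r_i)_{i \in I}$ be a pre-Rademacher family in a Boolean algebra $\mathcal{B}$. Then there is a unique finitely additive measure $\mu: \mathcal{B}(\mathcal{R}) \to [0,1]$ satisfying $$\mu\Bigl(\bigcap_{k=1}^n \theta_k r_{i_k}\Bigr) = \frac{1}{2^n}$$ for all finite collections of distinct indices $i_1,\ldots,i_n \in I$ and all collections of signs $\theta_1,\ldots,\theta_n \in \{-1,1\}$.
   Context: A Boolean algebra $\mathcal{B}$ has zero $\mathbf{0}$ and unit $\mathbf{1}$. For $x \in \mathcal{B}$ and a sign $\theta \in \{-1,1\}$ put $1x = x$ and $-1x = -x = \mathbf{1}\setminus x$. $\mathcal{B}(\mathcal{R})$ denotes the smallest subalgebra of $\mathcal{B}$ (containing $\mathbf{1}$) that includes $\mathcal{R}$. A family $\mathcal{R} = (r_i)_{i\in I}$ in $\mathcal{B}$ is a pre-Rademacher family if $\bigcap_{j\in J}\theta_j r_j \neq \mathbf{0}$ for every finite $J \subseteq I$ and all signs $\theta_j=\pm1$, $j\in J$. The intersection over the empty set is $\mathbf{1}$ by convention (so the displayed condition with $n=0$ reads $\mu(\mathbf{1})=1$). *)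

theory Defs
  imports Complex_Main "HOL-Library.FuncSet"
begin

text \<open>
  Meets of finite indexed families in a bounded lattice, set up like \<^const>\<open>sum\<close>. The library's
  \<^const>\<open>Inf_fin\<close> is unspecified on the empty set, whereas here the empty meet is \<^const>\<open>top\<close>.
\<close>

context bounded_semilattice_inf_top
begin

sublocale meet: comm_monoid_set inf top
  defines meet = meet.F
  ..

end

text \<open>The action of a sign \<open>s \<in> {-1, 1}\<close> on a Boolean algebra; other integers are not used.\<close>

definition signed :: "int \<Rightarrow> 'b::boolean_algebra \<Rightarrow> 'b"
  where "signed s x = (if s = -1 then - x else x)"

definition boolean_subalgebra :: "'b::boolean_algebra set \<Rightarrow> bool"
  where "boolean_subalgebra A \<longleftrightarrow>
    bot \<in> A \<and> top \<in> A \<and> (\<forall>x\<in>A. - x \<in> A) \<and>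
    (\<forall>x\<in>A. \<forall>y\<in>A. inf x y \<in> A) \<and> (\<forall>x\<in>A. \<forall>y\<in>A. sup x y \<in> A)"

definition generated_subalgebra :: "'b::boolean_algebra set \<Rightarrow> 'b set"
  where "generated_subalgebra R = boolean_subalgebra hull R"

text \<open>The hull is the intersection of all subalgebras including \<open>R\<close>; it is itself the smallest one.\<close>

lemma generated_subalgebra_smallest:
  fixes R :: "'b::boolean_algebra set"
  shows "boolean_subalgebra (generated_subalgebra R)"
    and "R \<subseteq> generated_subalgebra R"
    and "\<And>A. boolean_subalgebra A \<Longrightarrow> R \<subseteq> A \<Longrightarrow> generated_subalgebra R \<subseteq> A"
proof -
  show "boolean_subalgebra (generated_subalgebra R)"
    unfolding generated_subalgebra_def
    by (rule hull_in) (simp add: boolean_subalgebra_def)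
qed (simp_all add: generated_subalgebra_def hull_subset hull_minimal)

definition pre_rademacher :: "'i set \<Rightarrow> ('i \<Rightarrow> 'b::boolean_algebra) \<Rightarrow> bool"
  where "pre_rademacher I r \<longleftrightarrow>
    (\<forall>J \<theta>. finite J \<and> J \<subseteq> I \<and> \<theta> \<in> J \<rightarrow> {-1, 1} \<longrightarrow>
      meet (\<lambda>j. signed (\<theta> j) (r j)) J \<noteq> bot)"

text \<open>
  A finitely additive measure \<open>A \<rightarrow> [0,1]\<close> on a subalgebra \<open>A\<close>. Membership in \<open>A \<rightarrow>\<^sub>E {0..1}\<close> fixes
  the (irrelevant) values outside \<open>A\<close>, so that equality of such functions is equality on \<open>A\<close>.
\<close>

definition fin_additive_measure :: "'b::boolean_algebra set \<Rightarrow> ('b \<Rightarrow> real) \<Rightarrow> bool"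
  where "fin_additive_measure A \<mu> \<longleftrightarrow>
    \<mu> \<in> A \<rightarrow>\<^sub>E {0..1} \<and> \<mu> bot = 0 \<and>
    (\<forall>x\<in>A. \<forall>y\<in>A. inf x y = bot \<longrightarrow> \<mu> (sup x y) = \<mu> x + \<mu> y)"

end

theory Submission
  imports Defs
begin

text \<open>
  For finite \<open>J \<subseteq> I\<close> the family cuts the unit into \<open>2 ^ card J\<close> pairwise disjoint cells, all nonzero
  because the family is pre-Rademacher. Every element of the generated subalgebra is decided by some
  \<open>J\<close>, meaning that each cell lies below the element or below its complement. Additivity forces its
  measure to be the proportion of cells below it, and this proportion does not change when \<open>J\<close> is
  enlarged, which gives existence.
\<close>

section \<open>Cells cut out by a finite set of indices\<close>

lemma le_meet_iff:
  assumes "finite J"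
  shows "x \<le> meet f J \<longleftrightarrow> (\<forall>j\<in>J. x \<le> f j)"
  using assms by (induction J) auto

text \<open>A cell is encoded by the set \<open>S\<close> of its positive indices; only \<open>S \<inter> J\<close> matters.\<close>

definition cell :: "('i \<Rightarrow> 'b::boolean_algebra) \<Rightarrow> 'i set \<Rightarrow> 'i set \<Rightarrow> 'b"
  where "cell r J S = meet (\<lambda>j. if j \<in> S then r j else - r j) J"

definition decides :: "('i \<Rightarrow> 'b::boolean_algebra) \<Rightarrow> 'i set \<Rightarrow> 'b \<Rightarrow> bool"
  where "decides r J x \<longleftrightarrow> (\<forall>S. cell r J S \<le> x \<or> cell r J S \<le> - x)"

text \<open>A cell depends only on \<open>S \<inter> J\<close>, so letting \<open>S\<close> range
  over \<open>Pow J\<close> counts each sign pattern on \<open>J\<close> exactly once.\<close>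

definition cells_below :: "('i \<Rightarrow> 'b::boolean_algebra) \<Rightarrow> 'i set \<Rightarrow> 'b \<Rightarrow> 'i set set"
  where "cells_below r J x = {S \<in> Pow J. cell r J S \<le> x}"

definition cell_proportion :: "('i \<Rightarrow> 'b::boolean_algebra) \<Rightarrow> 'i set \<Rightarrow> 'b \<Rightarrow> real"
  where "cell_proportion r J x = card (cells_below r J x) / 2 ^ card J"

lemma cell_cong: "S \<inter> J = T \<inter> J \<Longrightarrow> cell r J S = cell r J T"
  unfolding cell_def by (rule meet.cong) auto

lemma cell_insert:
  assumes "finite J" "a \<notin> J"
  shows "cell r (insert a J) S = inf (if a \<in> S then r a else - r a) (cell r J S)"
  using assms by (simp add: cell_def)

lemma cell_le:
  assumes "finite J" "j \<in> J"
  shows "cell r J S \<le> (if j \<in> S then r j else - r j)"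
proof -
  have "\<forall>j\<in>J. cell r J S \<le> (if j \<in> S then r j else - r j)"
    unfolding cell_def le_meet_iff[OF assms(1), symmetric] by (rule order_refl)
  then show ?thesis using assms by blast
qed

lemma cell_antimono:
  assumes "finite K" "J \<subseteq> K"
  shows "cell r K S \<le> cell r J S"
proof -
  have "finite J" using assms finite_subset by blast
  then show ?thesis
    unfolding cell_def[of r J] le_meet_iff[OF \<open>finite J\<close>] using cell_le[OF assms(1)] assms(2) by blast
qed

lemma cell_neq_bot:
  assumes "pre_rademacher I r" "finite J" "J \<subseteq> I"
  shows "cell r J S \<noteq> bot"
proof -
  have "meet (\<lambda>j. signed (if j \<in> S then 1 else - 1) (r j)) J \<noteq> bot"
    using assms unfolding pre_rademacher_def
    by (elim allE[where x = J] allE[where x = "\<lambda>j. if j \<in> S then 1 else - 1"]) auto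
  moreover have "signed (if j \<in> S then 1 else - 1) (r j) = (if j \<in> S then r j else - r j)" for j
    by (simp add: signed_def)
  ultimately show ?thesis by (simp only: cell_def not_False_eq_True)
qed

lemma le_and_le_uminus_imp_bot:
  fixes x y :: "'b::boolean_algebra"
  assumes "x \<le> y" "x \<le> - y"
  shows "x = bot"
proof -
  have "x \<le> inf y (- y)" using assms by (rule le_infI)
  then show ?thesis by (simp add: bot_unique)
qed

text \<open>The sign patterns differ at some \<open>j \<in> J\<close>, so one cell lies below
  \<open>r j\<close> and the other below \<open>- r j\<close>. Disjointness is phrased with a
  complement to match the second alternative in \<open>decides\<close>.\<close>

lemma cell_disjoint:
  assumes "finite J" "S \<inter> J \<noteq> T \<inter> J"
  shows "cell r J S \<le> - cell r J T"
proof -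
  obtain j where j: "j \<in> J" "j \<in> S \<longleftrightarrow> j \<notin> T" using assms by blast
  have "cell r J S \<le> (if j \<in> S then r j else - r j)" by (rule cell_le) (use assms j in auto)
  also have "\<dots> = - (if j \<in> T then r j else - r j)" using j by auto
  also have "\<dots> \<le> - cell r J T"
    using cell_le[OF assms(1) j(1)] by (subst compl_le_compl_iff)
  finally show ?thesis .
qed

section \<open>Elements decided by a finite set of indices\<close>

lemma decides_mono:
  assumes "finite K" "J \<subseteq> K" "decides r J x"
  shows "decides r K x"
  using assms(3) cell_antimono[OF assms(1,2)] unfolding decides_def by (meson order_trans)

lemma decides_cell:
  assumes "finite J"
  shows "decides r J (cell r J S)"
  unfolding decides_def
proof
  fix T
  show "cell r J T \<le> cell r J S \<or> cell r J T \<le> - cell r J S"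
    using cell_cong[of T J S r] cell_disjoint[OF assms, of T S r] by (cases "T \<inter> J = S \<inter> J") auto
qed

lemma decides_sup:
  assumes "decides r J x" "decides r J y"
  shows "decides r J (sup x y)"
  unfolding decides_def
proof
  fix S
  have "cell r J S \<le> x \<or> cell r J S \<le> - x" "cell r J S \<le> y \<or> cell r J S \<le> - y"
    using assms by (auto simp: decides_def)
  then show "cell r J S \<le> sup x y \<or> cell r J S \<le> - sup x y"
    using le_supI1[of "cell r J S" x y] le_supI2[of "cell r J S" y x] by auto
qed

lemma decides_uminus: "decides r J (- x) \<longleftrightarrow> decides r J x"
  by (auto simp: decides_def)

lemma decides_inf:
  assumes "decides r J x" "decides r J y"
  shows "decides r J (inf x y)"
  using decides_sup[of r J "- x" "- y"] assms decides_uminus[of r J "inf x y"]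
  by (simp add: decides_uminus)

text \<open>The elements decided by some finite subset of \<open>I\<close> form a subalgebra
  containing every \<open>r i\<close>, since the cells of \<open>{i}\<close> are \<open>r i\<close>
  and its complement. Minimality of the generated subalgebra does the rest.\<close>

lemma decides_generated:
  assumes "x \<in> generated_subalgebra (r ` I)"
  obtains J where "finite J" "J \<subseteq> I" "decides r J x"
proof -
  define D where "D = {x. \<exists>J. finite J \<and> J \<subseteq> I \<and> decides r J x}"
  \<comment> \<open>Closure under \<open>inf\<close> and \<open>sup\<close> needs one index set
    deciding both arguments. The union of two deciding sets works, because enlarging a set refines
    its cells.\<close>
  have common: "\<exists>J. finite J \<and> J \<subseteq> I \<and> decides r J x \<and> decides r J y"
    if "x \<in> D" "y \<in> D" for x y
  proof -
    from that obtain J K where "finite J" "J \<subseteq> I" "decides r J x" "finite K" "K \<subseteq> I" "decides r K y"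
      unfolding D_def by blast
    then have "finite (J \<union> K) \<and> J \<union> K \<subseteq> I \<and> decides r (J \<union> K) x \<and> decides r (J \<union> K) y"
      using decides_mono[of "J \<union> K" J r x] decides_mono[of "J \<union> K" K r y] by simp
    then show ?thesis by blast
  qed
  have "decides r {} bot" "decides r {} top"
    by (auto simp: decides_def)
  then have "bot \<in> D" "top \<in> D" unfolding D_def by blast+
  moreover have "- x \<in> D" if "x \<in> D" for x
    using that by (simp add: D_def decides_uminus)
  moreover have "inf x y \<in> D" "sup x y \<in> D" if xy: "x \<in> D" "y \<in> D" for x y
  proof -
    obtain J where J: "finite J" "J \<subseteq> I" "decides r J x" "decides r J y"
      using common[OF xy] by blast
    then show "inf x y \<in> D" "sup x y \<in> D"
      unfolding D_def by (blast intro: decides_inf decides_sup)+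
  qed
  ultimately have "boolean_subalgebra D" by (simp add: boolean_subalgebra_def)
  moreover have "r ` I \<subseteq> D"
  proof safe
    fix i assume "i \<in> I"
    then have "finite {i} \<and> {i} \<subseteq> I \<and> decides r {i} (r i)" by (simp add: decides_def cell_def)
    then show "r i \<in> D" unfolding D_def by blast
  qed
  ultimately have "generated_subalgebra (r ` I) \<subseteq> D" by (rule generated_subalgebra_smallest(3))
  with assms have "x \<in> D" by blast
  with that show thesis unfolding D_def by blast
qed

lemma decides_generated_pair:
  assumes "x \<in> generated_subalgebra (r ` I)" "y \<in> generated_subalgebra (r ` I)"
  obtains J where "finite J" "J \<subseteq> I" "decides r J x" "decides r J y"
proof -
  obtain J where "finite J" "J \<subseteq> I" "decides r J x"
    using assms(1) by (rule decides_generated)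
  moreover obtain K where "finite K" "K \<subseteq> I" "decides r K y"
    using assms(2) by (rule decides_generated)
  ultimately show thesis
    using decides_mono[of "J \<union> K" J r x] decides_mono[of "J \<union> K" K r y] that[of "J \<union> K"] by simp
qed

lemma cell_in_generated:
  assumes "finite J" "J \<subseteq> I"
  shows "cell r J S \<in> generated_subalgebra (r ` I)"
  using assms
proof (induction J)
  case empty
  then show ?case
    using generated_subalgebra_smallest(1)[of "r ` I"] by (simp add: cell_def boolean_subalgebra_def)
next
  case (insert a J)
  then have "r a \<in> generated_subalgebra (r ` I)"
    using generated_subalgebra_smallest(2)[of "r ` I"] by blast
  with insert show ?case
    using generated_subalgebra_smallest(1)[of "r ` I"] by (simp add: cell_insert boolean_subalgebra_def)
qed

section \<open>Proportion of cells below an element\<close>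

lemma finite_cells_below: "finite J \<Longrightarrow> finite (cells_below r J x)"
  by (simp add: cells_below_def)

text \<open>Each cell of \<open>J\<close> splits into \<open>2 ^ card (K - J)\<close> cells of
  \<open>K\<close>, so numerator and denominator of the proportion grow by the same factor.\<close>

lemma cell_proportion_mono_eq:
  assumes pre: "pre_rademacher I r" and K: "finite K" "K \<subseteq> I" and "J \<subseteq> K" and dec: "decides r J x"
  shows "cell_proportion r K x = cell_proportion r J x"
proof -
  have "finite J" using K \<open>J \<subseteq> K\<close> finite_subset by blast
  \<comment> \<open>A cell of \<open>K\<close> lies inside the cell of \<open>J\<close> with the
    same signs on \<open>J\<close>. If that larger cell were below \<open>- x\<close> while the
    smaller one is below \<open>x\<close>, the smaller one would be zero.\<close>
  have le_iff: "cell r K S \<le> x \<longleftrightarrow> cell r J (S \<inter> J) \<le> x" for S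
  proof -
    have "cell r K S \<le> cell r J (S \<inter> J)"
      using cell_antimono[OF K(1) \<open>J \<subseteq> K\<close>, of r S] cell_cong[of S J "S \<inter> J" r] by simp
    moreover have "cell r J (S \<inter> J) \<le> x \<or> cell r J (S \<inter> J) \<le> - x"
      using dec by (simp add: decides_def)
    ultimately show ?thesis
      using cell_neq_bot[OF pre K] le_and_le_uminus_imp_bot by (metis order_trans)
  qed
  \<comment> \<open>By \<open>le_iff\<close> only the trace of a sign pattern on \<open>J\<close>
    matters; the trace on \<open>K - J\<close> is free.\<close>
  have "bij_betw (\<lambda>(A, B). A \<union> B) (cells_below r J x \<times> Pow (K - J)) (cells_below r K x)"
  proof (rule bij_betw_byWitness[where f' = "\<lambda>S. (S \<inter> J, S - J)"])
    show "(\<lambda>(A, B). A \<union> B) ` (cells_below r J x \<times> Pow (K - J)) \<subseteq> cells_below r K x"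
    proof clarify
      fix A B assume A: "A \<in> cells_below r J x" and B: "B \<subseteq> K - J"
      then have "(A \<union> B) \<inter> J = A" by (auto simp: cells_below_def)
      with A B \<open>J \<subseteq> K\<close> show "A \<union> B \<in> cells_below r K x"
        by (auto simp: cells_below_def le_iff)
    qed
  qed (use \<open>J \<subseteq> K\<close> in \<open>auto simp: cells_below_def le_iff\<close>)
  then have "card (cells_below r K x) = card (cells_below r J x) * 2 ^ card (K - J)"
    using K by (simp add: bij_betw_same_card[symmetric] card_cartesian_product card_Pow)
  moreover have "card K = card J + card (K - J)"
    using K \<open>J \<subseteq> K\<close> \<open>finite J\<close> by (simp add: card_Diff_subset card_mono)
  ultimately show ?thesis by (simp add: cell_proportion_def power_add)
qed

text \<open>Both proportions equal the one for \<open>J \<union> K\<close>. This makes the value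
  independent of the deciding set chosen.\<close>

lemma cell_proportion_unique:
  assumes "pre_rademacher I r"
    and "finite J" "J \<subseteq> I" "decides r J x" "finite K" "K \<subseteq> I" "decides r K x"
  shows "cell_proportion r J x = cell_proportion r K x"
  using assms cell_proportion_mono_eq[OF assms(1), of "J \<union> K" J x]
    cell_proportion_mono_eq[OF assms(1), of "J \<union> K" K x] by simp

text \<open>A cell below \<open>sup x y\<close> but not below \<open>x\<close> is below
  \<open>- x\<close>, as \<open>J\<close> decides \<open>x\<close>, and hence below
  \<open>y\<close>. No cell is counted twice, since cells are nonzero and \<open>x\<close>,
  \<open>y\<close> are disjoint.\<close>

lemma cell_proportion_sup:
  assumes pre: "pre_rademacher I r" and J: "finite J" "J \<subseteq> I"
    and dec: "decides r J x" and disj: "inf x y = bot"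
  shows "cell_proportion r J (sup x y) = cell_proportion r J x + cell_proportion r J y"
proof -
  have "cell r J S \<le> y" if "cell r J S \<le> sup x y" "\<not> cell r J S \<le> x" for S
  proof -
    have "cell r J S \<le> inf (sup x y) (- x)" using that dec by (auto simp: decides_def)
    also have "\<dots> \<le> y" by (simp add: inf_sup_distrib2)
    finally show ?thesis .
  qed
  then have "cells_below r J (sup x y) = cells_below r J x \<union> cells_below r J y"
    by (auto simp: cells_below_def intro: le_supI1 le_supI2)
  moreover have "\<not> (cell r J S \<le> x \<and> cell r J S \<le> y)" for S
    using cell_neq_bot[OF pre J, of S] disj by (simp add: bot_unique flip: le_inf_iff)
  then have "cells_below r J x \<inter> cells_below r J y = {}"
    by (auto simp: cells_below_def)
  ultimately have "card (cells_below r J (sup x y)) = card (cells_below r J x) + card (cells_below r J y)"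
    using J by (simp add: card_Un_disjoint finite_cells_below)
  then show ?thesis by (simp add: cell_proportion_def add_divide_distrib)
qed

lemma cell_proportion_cell:
  assumes pre: "pre_rademacher I r" and J: "finite J" "J \<subseteq> I"
  shows "cell_proportion r J (cell r J S) = 1 / 2 ^ card J"
proof -
  have "cell r J T \<le> cell r J S \<longleftrightarrow> T \<inter> J = S \<inter> J" for T
    using cell_cong[of T J S r] cell_disjoint[OF J(1), of T S r] cell_neq_bot[OF pre J]
      le_and_le_uminus_imp_bot by (metis order_refl)
  then have "cells_below r J (cell r J S) = {S \<inter> J}"
    by (auto simp: cells_below_def)
  then show ?thesis by (simp add: cell_proportion_def)
qed

section \<open>Cells as signed meets over enumerated indices\<close>

lemma meet_signed_eq_cell:
  assumes "inj_on i {1..n::nat}" "\<theta> \<in> {1..n} \<rightarrow> {-1, 1::int}"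
  shows "meet (\<lambda>k. signed (\<theta> k) (r (i k))) {1..n} = cell r (i ` {1..n}) (i ` {k\<in>{1..n}. \<theta> k = 1})"
  unfolding cell_def meet.reindex[OF assms(1)]
proof (rule meet.cong)
  fix k assume k: "k \<in> {1..n}"
  then have "i k \<in> i ` {k\<in>{1..n}. \<theta> k = 1} \<longleftrightarrow> \<theta> k = 1"
    using assms(1) by (auto dest: inj_onD)
  moreover have "\<theta> k = - 1 \<or> \<theta> k = 1" using assms(2) k by auto
  ultimately show "signed (\<theta> k) (r (i k)) =
      ((\<lambda>j. if j \<in> i ` {k\<in>{1..n}. \<theta> k = 1} then r j else - r j) \<circ> i) k"
    by (auto simp: signed_def)
qed simp

text \<open>Enumerating \<open>J\<close> gives the converse translation, through which the
  prescribed values of a measure on signed meets become values on all cells.\<close>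

lemma cell_eq_meet_signed:
  assumes "finite J"
  obtains i \<theta> where "i ` {1..card J} = J" "inj_on i {1..card J}" "\<theta> \<in> {1..card J} \<rightarrow> {-1, 1::int}"
    "cell r J S = meet (\<lambda>k. signed (\<theta> k) (r (i k))) {1..card J}"
proof -
  obtain i where "bij_betw i {1..card J} J"
    using ex_bij_betw_nat_finite_1[OF assms] by blast
  then have i: "i ` {1..card J} = J" "inj_on i {1..card J}"
    by (auto simp: bij_betw_def)
  define \<theta> :: "nat \<Rightarrow> int" where "\<theta> k = (if i k \<in> S then 1 else - 1)" for k
  have \<theta>: "\<theta> \<in> {1..card J} \<rightarrow> {-1, 1}" by (simp add: \<theta>_def)
  have "i ` {k\<in>{1..card J}. \<theta> k = 1} = S \<inter> i ` {1..card J}"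
    by (auto simp: \<theta>_def)
  then have "i ` {k\<in>{1..card J}. \<theta> k = 1} = S \<inter> J" unfolding i(1) .
  then have "cell r J S = meet (\<lambda>k. signed (\<theta> k) (r (i k))) {1..card J}"
    using meet_signed_eq_cell[OF i(2) \<theta>, of r] cell_cong[of S J "S \<inter> J" r] i(1) by simp
  with i \<theta> show thesis by (rule that)
qed

section \<open>Measures are determined by their values on cells\<close>

text \<open>By induction on \<open>J\<close>: a new index \<open>a\<close> cuts every piece into its
  parts inside and outside \<open>r a\<close>, and additivity splits each summand
  accordingly.\<close>

lemma measure_sum_cells:
  assumes \<mu>: "fin_additive_measure (generated_subalgebra (r ` I)) \<mu>"
    and "finite J" "J \<subseteq> I" and x: "x \<in> generated_subalgebra (r ` I)"
  shows "\<mu> x = (\<Sum>S\<in>Pow J. \<mu> (inf x (cell r J S)))"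
  using assms(2,3)
proof (induction J)
  case empty
  then show ?case by (simp add: cell_def)
next
  case (insert a J)
  let ?G = "generated_subalgebra (r ` I)"
  have sub: "boolean_subalgebra ?G" by (rule generated_subalgebra_smallest(1))
  have a: "r a \<in> ?G" "- r a \<in> ?G"
    using insert.prems generated_subalgebra_smallest(2)[of "r ` I"] sub
    by (auto simp: boolean_subalgebra_def)
  \<comment> \<open>Since \<open>a\<close> is not in \<open>S\<close>, the part below
    \<open>- r a\<close> belongs to the pattern \<open>S\<close> and the part below
    \<open>r a\<close> to \<open>insert a S\<close>. These two kinds of pattern together make up
    \<open>Pow (insert a J)\<close>.\<close>
  have split: "\<mu> (inf x (cell r J S)) =
      \<mu> (inf x (cell r (insert a J) S)) + \<mu> (inf x (cell r (insert a J) (insert a S)))"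
    if S: "S \<in> Pow J" for S
  proof -
    let ?z = "inf x (cell r J S)"
    have "?z \<in> ?G" using x cell_in_generated[of J I r S] insert.hyps insert.prems sub
      by (auto simp: boolean_subalgebra_def)
    then have "inf ?z (- r a) \<in> ?G" "inf ?z (r a) \<in> ?G" using a sub by (auto simp: boolean_subalgebra_def)
    moreover have "inf (inf ?z (- r a)) (inf ?z (r a)) = bot"
      by (rule le_and_le_uminus_imp_bot[of _ "r a"]) (auto intro: le_infI1 le_infI2)
    ultimately have "\<mu> (sup (inf ?z (- r a)) (inf ?z (r a))) = \<mu> (inf ?z (- r a)) + \<mu> (inf ?z (r a))"
      using \<mu> by (simp add: fin_additive_measure_def)
    moreover have "sup (inf ?z (- r a)) (inf ?z (r a)) = ?z"
      by (simp flip: inf_sup_distrib1)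
    moreover have "a \<notin> S" using S insert.hyps by auto
    then have "cell r (insert a J) S = inf (- r a) (cell r J S)"
      using insert.hyps by (simp add: cell_insert)
    moreover have "cell r (insert a J) (insert a S) = inf (r a) (cell r J S)"
      using insert.hyps cell_cong[of "insert a S" J S r] by (simp add: cell_insert)
    ultimately show ?thesis by (simp add: ac_simps)
  qed
  have inj: "inj_on (insert a) (Pow J)"
    using insert.hyps by (auto simp: inj_on_def)
  have "\<mu> x = (\<Sum>S\<in>Pow J. \<mu> (inf x (cell r J S)))" using insert by simp
  also have "\<dots> = (\<Sum>S\<in>Pow J. \<mu> (inf x (cell r (insert a J) S))) +
      (\<Sum>S\<in>Pow J. \<mu> (inf x (cell r (insert a J) (insert a S))))"
    by (simp add: split sum.distrib)
  also have "\<dots> = (\<Sum>S\<in>Pow J. \<mu> (inf x (cell r (insert a J) S))) +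
      (\<Sum>S\<in>insert a ` Pow J. \<mu> (inf x (cell r (insert a J) S)))"
    by (simp add: sum.reindex[OF inj])
  also have "\<dots> = (\<Sum>S\<in>Pow (insert a J). \<mu> (inf x (cell r (insert a J) S)))"
    unfolding Pow_insert by (rule sum.union_disjoint[symmetric]) (use insert.hyps in auto)
  finally show ?case .
qed

text \<open>As \<open>J\<close> decides \<open>x\<close>, each term of the decomposition over cells
  is the measure of a whole cell or of \<open>bot\<close>, so the sum just counts the cells below
  \<open>x\<close>.\<close>

lemma measure_eq_cell_proportion:
  assumes \<mu>: "fin_additive_measure (generated_subalgebra (r ` I)) \<mu>"
    and cell: "\<And>S. \<mu> (cell r J S) = 1 / 2 ^ card J"
    and J: "finite J" "J \<subseteq> I" and dec: "decides r J x"
    and x: "x \<in> generated_subalgebra (r ` I)"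
  shows "\<mu> x = cell_proportion r J x"
proof -
  have "\<mu> (inf x (cell r J S)) = (if cell r J S \<le> x then 1 / 2 ^ card J else 0)" for S
  proof (cases "cell r J S \<le> x")
    case True
    then show ?thesis by (simp add: inf_absorb2 cell)
  next
    case False
    then have "cell r J S \<le> - x" using dec by (auto simp: decides_def)
    then have "inf x (cell r J S) = bot"
      by (intro le_and_le_uminus_imp_bot[of _ x]) (auto intro: le_infI2)
    then show ?thesis using False \<mu> by (simp add: fin_additive_measure_def)
  qed
  then have "\<mu> x = (\<Sum>S\<in>Pow J. if cell r J S \<le> x then 1 / 2 ^ card J else 0)"
    using measure_sum_cells[OF \<mu> J x] by simp
  also have "\<dots> = cell_proportion r J x"
    using J by (simp add: sum.If_cases cell_proportion_def cells_below_def Int_def Pow_def)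
  finally show ?thesis .
qed

section \<open>Existence of the measure\<close>

lemma ex_fin_additive_measure_cell_proportion:
  assumes pre: "pre_rademacher I r"
  obtains \<mu> where "fin_additive_measure (generated_subalgebra (r ` I)) \<mu>"
    and "\<And>J x. finite J \<Longrightarrow> J \<subseteq> I \<Longrightarrow> decides r J x \<Longrightarrow> x \<in> generated_subalgebra (r ` I) \<Longrightarrow>
      \<mu> x = cell_proportion r J x"
proof -
  let ?G = "generated_subalgebra (r ` I)"
  \<comment> \<open>Any deciding set may be chosen, because \<open>cell_proportion_unique\<close>
    shows that the value does not depend on it. The restricted abstraction supplies the default
    value \<open>undefined\<close> outside \<open>?G\<close> that extensionality demands.\<close>
  define \<mu> where "\<mu> = (\<lambda>x\<in>?G. cell_proportion r (SOME J. finite J \<and> J \<subseteq> I \<and> decides r J x) x)"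
  have eq: "\<mu> x = cell_proportion r J x"
    if "finite J" "J \<subseteq> I" "decides r J x" "x \<in> ?G" for J x
  proof -
    have "\<exists>J. finite J \<and> J \<subseteq> I \<and> decides r J x" using that by blast
    from someI_ex[OF this] show ?thesis
      using that by (auto simp: \<mu>_def intro!: cell_proportion_unique[OF pre])
  qed
  have "\<mu> \<in> ?G \<rightarrow>\<^sub>E {0..1}"
  proof (rule PiE_I)
    fix x assume "x \<in> ?G"
    moreover from this obtain J where J: "finite J" "J \<subseteq> I" "decides r J x" by (rule decides_generated)
    moreover have "card (cells_below r J x) \<le> card (Pow J)"
      using J by (intro card_mono) (auto simp: cells_below_def)
    then have "real (card (cells_below r J x)) \<le> real (2 ^ card J)"
      unfolding card_Pow[OF J(1)] by (rule of_nat_mono)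
    ultimately show "\<mu> x \<in> {0..1}" by (simp add: eq cell_proportion_def)
  qed (simp add: \<mu>_def)
  moreover have "\<mu> bot = 0"
  proof -
    have "bot \<in> ?G" using generated_subalgebra_smallest(1)[of "r ` I"] by (auto simp: boolean_subalgebra_def)
    \<comment> \<open>The empty set decides \<open>bot\<close>; its only cell is \<open>top\<close>,
      which is nonzero, so the count below \<open>bot\<close> is 0.\<close>
    then have "\<mu> bot = cell_proportion r {} bot" by (intro eq) (auto simp: decides_def)
    then show ?thesis
      using cell_neq_bot[OF pre, of "{}"] by (simp add: cell_proportion_def cells_below_def bot_unique)
  qed
  moreover have "\<mu> (sup x y) = \<mu> x + \<mu> y" if xy: "x \<in> ?G" "y \<in> ?G" "inf x y = bot" for x y
  proof -
    \<comment> \<open>With one set deciding \<open>x\<close> and \<open>y\<close>, and so also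
      \<open>sup x y\<close>, all three measures are proportions among the same cells.\<close>
    obtain J where J: "finite J" "J \<subseteq> I" "decides r J x" "decides r J y"
      by (rule decides_generated_pair[OF xy(1,2)])
    then have "decides r J (sup x y)" by (simp add: decides_sup)
    moreover have "sup x y \<in> ?G"
      using generated_subalgebra_smallest(1)[of "r ` I"] xy by (auto simp: boolean_subalgebra_def)
    ultimately show ?thesis
      using J xy cell_proportion_sup[OF pre J(1-3) xy(3)] by (simp add: eq)
  qed
  ultimately have "fin_additive_measure ?G \<mu>" by (simp add: fin_additive_measure_def)
  with eq show thesis by (rule that[rotated])
qed

theorem theorem2p15:
  fixes I :: "'i set" and r :: "'i \<Rightarrow> 'b::boolean_algebra"
  assumes "pre_rademacher I r"
  shows "\<exists>!\<mu> :: 'b \<Rightarrow> real. fin_additive_measure (generated_subalgebra (r ` I)) \<mu> \<and>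
    (\<forall>(n::nat) (i :: nat \<Rightarrow> 'i) (\<theta> :: nat \<Rightarrow> int).
      i \<in> {1..n} \<rightarrow> I \<and> inj_on i {1..n} \<and> \<theta> \<in> {1..n} \<rightarrow> {-1, 1} \<longrightarrow>
      \<mu> (meet (\<lambda>k. signed (\<theta> k) (r (i k))) {1..n}) = 1 / 2 ^ n)"
    (is "\<exists>!\<mu>. ?M \<mu> \<and> ?R \<mu>")
proof (rule ex_ex1I)
  obtain \<mu> where \<mu>: "?M \<mu>" and eq: "\<And>J x. finite J \<Longrightarrow> J \<subseteq> I \<Longrightarrow> decides r J x \<Longrightarrow>
      x \<in> generated_subalgebra (r ` I) \<Longrightarrow> \<mu> x = cell_proportion r J x"
    using ex_fin_additive_measure_cell_proportion[OF assms] by blast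
  have "?R \<mu>"
  proof (intro allI impI, elim conjE)
    fix n :: nat and i and \<theta> :: "nat \<Rightarrow> int"
    assume i: "i \<in> {1..n} \<rightarrow> I" "inj_on i {1..n}" and \<theta>: "\<theta> \<in> {1..n} \<rightarrow> {-1, 1}"
    have J: "finite (i ` {1..n})" "i ` {1..n} \<subseteq> I" using i by auto
    have "card (i ` {1..n}) = n" using card_image[OF i(2)] by simp
    then show "\<mu> (meet (\<lambda>k. signed (\<theta> k) (r (i k))) {1..n}) = 1 / 2 ^ n"
      unfolding meet_signed_eq_cell[OF i(2) \<theta>]
        eq[OF J decides_cell[OF J(1)] cell_in_generated[OF J]] cell_proportion_cell[OF assms J]
      by simp
  qed
  with \<mu> show "\<exists>\<mu>. ?M \<mu> \<and> ?R \<mu>" by blast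
next
  let ?G = "generated_subalgebra (r ` I)"
  \<comment> \<open>The formula on the right does not mention \<open>\<rho>\<close>, so any two
    solutions agree on \<open>?G\<close>; outside \<open>?G\<close> both are
    \<open>undefined\<close>.\<close>
  have eq: "\<rho> x = cell_proportion r J x"
    if \<rho>: "?M \<rho> \<and> ?R \<rho>" and J: "finite J" "J \<subseteq> I" "decides r J x" and x: "x \<in> ?G" for \<rho> J x
  proof (rule measure_eq_cell_proportion[OF _ _ J x])
    show "?M \<rho>" using \<rho> by blast
    show "\<rho> (cell r J S) = 1 / 2 ^ card J" for S
    proof -
      obtain i and \<theta> :: "nat \<Rightarrow> int" where i: "i ` {1..card J} = J" "inj_on i {1..card J}"
        and \<theta>: "\<theta> \<in> {1..card J} \<rightarrow> {-1, 1}"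
        and "cell r J S = meet (\<lambda>k. signed (\<theta> k) (r (i k))) {1..card J}"
        by (rule cell_eq_meet_signed[OF J(1)])
      moreover have "i \<in> {1..card J} \<rightarrow> I" using i J by blast
      ultimately show ?thesis using \<rho> by simp
    qed
  qed
  fix \<mu> \<nu> assume \<mu>: "?M \<mu> \<and> ?R \<mu>" and \<nu>: "?M \<nu> \<and> ?R \<nu>"
  show "\<mu> = \<nu>"
  proof (rule PiE_ext)
    show "\<mu> \<in> ?G \<rightarrow>\<^sub>E {0..1}" "\<nu> \<in> ?G \<rightarrow>\<^sub>E {0..1}"
      using \<mu> \<nu> unfolding fin_additive_measure_def by blast+
    fix x assume x: "x \<in> ?G"
    then obtain J where J: "finite J" "J \<subseteq> I" "decides r J x" by (rule decides_generated)
    show "\<mu> x = \<nu> x" by (simp only: eq[OF \<mu> J x] eq[OF \<nu> J x])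
  qed
qed

end
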